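(* Let $N\in\mathbb{N}$, let $\lambda_{ij}\ge0$ for $i,j\in[N]$, $i\neq j$, and suppose that the interaction weights satisfy componentwise strong connectivity with vertex sets $S_1,\dots,S_m$ (see context). Then the optimization problem $$r^\star:=\inf_{p\in(0,\infty)^N}\max_{i\in[N]}\frac1{p_i}\sum_{j\ne i}|p_i\lambda_{ij}-p_j\lambda_{ji}|$$ is equivalent to $$\begin{aligned}\min_{p\in[0,\infty)^N,\ r\in[0,r_0]}\quad& r\\ \text{s.t.}\quad&\sum_{j\ne i}|p_i\lambda_{ij}-p_j\lambda_{ji}|\le r\,p_i,\quad i\in[N],\\ &\sum_{i\in S_k}p_i=|S_k|,\quad k=1,\dots,m,\end{aligned}$$ where $r_0:=\max_{i\in[N]}\sum_{j\ne i}|\lambda_{ij}-\lambda_{ji}|$. Consequently, the infimum defining $r^\star$ is attained by some $p^\star\in(0,\infty)^N$.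
   Context: $[N]=\{1,\dots,N\}$, and $|S_k|$ denotes the number of elements of $S_k$. The directed interaction graph $\mathcal G_\lambda=([N],E_\lambda)$ has a directed edge $j\to i$ if and only if $\lambda_{ij}>0$. Componentwise strong connectivity: $\mathcal G_\lambda$ can be decomposed into a disjoint union of strongly connected subgraphs with vertex sets $S_1,\dots,S_m$, that is, $[N]=S_1\cup\cdots\cup S_m$, each subgraph induced by $S_k$ is strongly connected (for any two of its vertices $i$ and $j$ there exists a directed path from $i$ to $j$), and there are no edges between distinct subgraphs, i.e. $\lambda_{ij}=\lambda_{ji}=0$ for all $i\in S_k$, $j\in S_\ell$, $k\ne\ell$. *)

theory Defs
  imports "HOL-Analysis.Analysis" "Graph_Theory.Digraph_Component"
begin

text \<open>
  The index set \<open>[N]\<close> is the universe of a finite type \<open>'n\<close>, so \<open>N = CARD('n) \<ge> 1\<close>, and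
  \<open>p\<close> ranges over \<open>real ^ 'n\<close>. The weights \<open>w i j\<close> stand for the \<open>\<lambda>\<^sub>i\<^sub>j\<close>; the
  diagonal values \<open>w i i\<close> are never used.
\<close>

text \<open>An arc is the pair (source, target): the arc \<open>(j, i)\<close> is present iff \<open>w i j > 0\<close>.\<close>

definition interaction_graph :: "('n \<Rightarrow> 'n \<Rightarrow> real) \<Rightarrow> ('n, 'n \<times> 'n) pre_digraph" where
  "interaction_graph w =
     \<lparr>verts = UNIV, arcs = {(j, i). i \<noteq> j \<and> 0 < w i j}, tail = fst, head = snd\<rparr>"

definition componentwise_strongly_connected ::
    "('n \<Rightarrow> 'n \<Rightarrow> real) \<Rightarrow> nat \<Rightarrow> (nat \<Rightarrow> 'n set) \<Rightarrow> bool" where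
  "componentwise_strongly_connected w m S \<longleftrightarrow>
     (\<Union>k\<in>{1..m}. S k) = UNIV \<and>
     disjoint_family_on S {1..m} \<and>
     (\<forall>k\<in>{1..m}. strongly_connected (interaction_graph w \<restriction> S k)) \<and>
     (\<forall>k\<in>{1..m}. \<forall>l\<in>{1..m}. k \<noteq> l \<longrightarrow> (\<forall>i\<in>S k. \<forall>j\<in>S l. w i j = 0 \<and> w j i = 0))"

definition imbalance :: "('n::finite \<Rightarrow> 'n \<Rightarrow> real) \<Rightarrow> real ^ 'n \<Rightarrow> 'n \<Rightarrow> real" where
  "imbalance w p i = (\<Sum>j | j \<noteq> i. \<bar>p $ i * w i j - p $ j * w j i\<bar>)"

definition pos_vecs :: "(real ^ 'n) set" where
  "pos_vecs = {p. \<forall>i. 0 < p $ i}"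

definition objective :: "('n::finite \<Rightarrow> 'n \<Rightarrow> real) \<Rightarrow> real ^ 'n \<Rightarrow> real" where
  "objective w p = (MAX i. 1 / p $ i * imbalance w p i)"

definition r_star :: "('n::finite \<Rightarrow> 'n \<Rightarrow> real) \<Rightarrow> real" where
  "r_star w = (INF p\<in>pos_vecs. objective w p)"

definition r_zero :: "('n::finite \<Rightarrow> 'n \<Rightarrow> real) \<Rightarrow> real" where
  "r_zero w = (MAX i. \<Sum>j | j \<noteq> i. \<bar>w i j - w j i\<bar>)"

definition normalized :: "nat \<Rightarrow> (nat \<Rightarrow> 'n::finite set) \<Rightarrow> real ^ 'n \<Rightarrow> bool" where
  "normalized m S p \<longleftrightarrow> (\<forall>k\<in>{1..m}. (\<Sum>i\<in>S k. p $ i) = real (card (S k)))"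

definition feasible ::
    "('n::finite \<Rightarrow> 'n \<Rightarrow> real) \<Rightarrow> nat \<Rightarrow> (nat \<Rightarrow> 'n set) \<Rightarrow> ((real ^ 'n) \<times> real) set" where
  "feasible w m S =
     {(p, r). (\<forall>i. 0 \<le> p $ i) \<and> r \<in> {0..r_zero w} \<and>
              (\<forall>i. imbalance w p i \<le> r * p $ i) \<and> normalized m S p}"

definition inf_solution :: "('n::finite \<Rightarrow> 'n \<Rightarrow> real) \<Rightarrow> real ^ 'n \<Rightarrow> bool" where
  "inf_solution w p \<longleftrightarrow> is_arg_min (objective w) (\<lambda>q. q \<in> pos_vecs) p"

definition min_solution ::
    "('n::finite \<Rightarrow> 'n \<Rightarrow> real) \<Rightarrow> nat \<Rightarrow> (nat \<Rightarrow> 'n set) \<Rightarrow> real ^ 'n \<Rightarrow> real \<Rightarrow> bool" where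
  "min_solution w m S p r \<longleftrightarrow> is_arg_min snd (\<lambda>x. x \<in> feasible w m S) (p, r)"

text \<open>
  Rescaling of \<open>p\<close> on each \<open>S k\<close> separately so as to meet the normalization constraint. When the
  sets \<open>S k\<close> partition the universe, the outer sum has exactly one summand.
\<close>

definition rescale :: "nat \<Rightarrow> (nat \<Rightarrow> 'n::finite set) \<Rightarrow> real ^ 'n \<Rightarrow> real ^ 'n" where
  "rescale m S p =
     (\<chi> i. \<Sum>k | k \<in> {1..m} \<and> i \<in> S k. real (card (S k)) * p $ i / (\<Sum>j\<in>S k. p $ j))"

end

(* On the feasible set of the constrained problem a zero of p propagates along arcs: if p_i = 0 then
   all terms of the i-th imbalance vanish, so p_j = 0 for every arc from i to j. By strong connectivity
   p would vanish on a whole component, contradicting the normalization; hence feasible points are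
   positive. The feasible set is compact, so the minimum of r is attained, at a positive p. Conversely,
   rescaling a positive p on each component does not change the objective, because arcs between
   components are absent. *)
theory Submission
  imports Defs
begin

section \<open>Components, objective and optimality\<close>

lemma componentE:
  assumes "componentwise_strongly_connected w m S"
  obtains k where "k \<in> {1..m}" "i \<in> S k"
  using assms unfolding componentwise_strongly_connected_def by blast

lemma component_unique:
  assumes "componentwise_strongly_connected w m S"
    and "k \<in> {1..m}" "l \<in> {1..m}" "i \<in> S k" "i \<in> S l"
  shows "k = l"
  using assms unfolding componentwise_strongly_connected_def disjoint_family_on_def by blast

lemma imbalance_nonneg: "0 \<le> imbalance w p i"
  unfolding imbalance_def by (rule sum_nonneg) simp

text \<open>Clearing the positive denominators turns a bound on the maximum into the constraints of
  \<open>feasible\<close>.\<close>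

lemma objective_le_iff:
  assumes "p \<in> pos_vecs"
  shows "objective w p \<le> r \<longleftrightarrow> (\<forall>i. imbalance w p i \<le> r * p $ i)"
  using assms unfolding objective_def pos_vecs_def by (simp add: pos_divide_le_eq)

lemma objective_nonneg:
  assumes "p \<in> pos_vecs"
  shows "0 \<le> objective w p"
proof -
  have "0 \<le> 1 / p $ i * imbalance w p i" for i
    using assms imbalance_nonneg[of w p i] by (simp add: pos_vecs_def less_imp_le)
  also have "1 / p $ i * imbalance w p i \<le> objective w p" for i
    unfolding objective_def by (rule Max_ge) auto
  finally show ?thesis by simp
qed

lemma one_in_pos_vecs: "(\<chi> i. 1) \<in> pos_vecs"
  by (simp add: pos_vecs_def)

text \<open>The origin of \<open>r_zero\<close>: it is the value at the constant vector, so the cap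
  on \<open>r\<close> cuts off no minimiser.\<close>

lemma objective_one: "objective w (\<chi> i. 1) = r_zero w"
  by (simp add: objective_def r_zero_def imbalance_def)

lemma inf_solution_iff:
  "inf_solution w p \<longleftrightarrow> p \<in> pos_vecs \<and> (\<forall>q\<in>pos_vecs. objective w p \<le> objective w q)"
  by (auto simp: inf_solution_def is_arg_min_linorder)

lemma min_solution_iff:
  "min_solution w m S p r \<longleftrightarrow>
     (p, r) \<in> feasible w m S \<and> (\<forall>q s. (q, s) \<in> feasible w m S \<longrightarrow> r \<le> s)"
  by (auto simp: min_solution_def is_arg_min_linorder)

lemma r_star_eq_objective:
  assumes "inf_solution w p"
  shows "r_star w = objective w p"
  unfolding r_star_def using assms
  by (intro cInf_eq_minimum) (auto simp: inf_solution_iff)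

section \<open>Positivity of feasible points\<close>

lemma zero_propagates:
  assumes "imbalance w p i \<le> 0" "p $ i = 0" "i \<noteq> j" "w j i > 0"
  shows "p $ j = 0"
proof -
  have "imbalance w p i = 0"
    using assms(1) imbalance_nonneg[of w p i] by linarith
  then have "\<forall>j\<in>{j. j \<noteq> i}. \<bar>p $ i * w i j - p $ j * w j i\<bar> = 0"
    unfolding imbalance_def by (subst (asm) sum_nonneg_eq_0_iff) auto
  then show ?thesis using assms by auto
qed

lemma feasible_pos:
  assumes conn: "componentwise_strongly_connected w m S"
    and feas: "(p, r) \<in> feasible w m S"
  shows "p \<in> pos_vecs"
proof (rule ccontr)
  assume "p \<notin> pos_vecs"
  then obtain i where "p $ i \<le> 0"
    by (auto simp: pos_vecs_def not_less)
  moreover have "0 \<le> p $ i"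
    using feas by (simp add: feasible_def)
  ultimately have i0: "p $ i = 0" by linarith
  obtain k where k: "k \<in> {1..m}" "i \<in> S k" using componentE[OF conn] by blast
  have sc: "strongly_connected (interaction_graph w \<restriction> S k)"
    using conn k unfolding componentwise_strongly_connected_def by blast
  have "p $ j = 0" if "j \<in> S k" for j
  proof -
    have "i \<rightarrow>\<^sup>*\<^bsub>interaction_graph w \<restriction> S k\<^esub> j"
      using sc k that by (auto simp: strongly_connected_def)
    then show ?thesis
      unfolding reachable_def
    proof (induction rule: rtrancl_on_induct)
      case base
      show ?case by (rule i0)
    next
      case (step x y)
      \<comment> \<open>The indices are reversed: an arc from \<open>x\<close> to \<open>y\<close>
        carries the weight \<open>w y x\<close>.\<close>
      from step.hyps(2) have "x \<noteq> y" "w y x > 0"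
        by (auto simp: interaction_graph_def arcs_ends_conv)
      moreover have "imbalance w p x \<le> r * p $ x"
        using feas by (simp add: feasible_def)
      \<comment> \<open>By the induction hypothesis \<open>p $ x = 0\<close>, so the bound
        \<open>r * p $ x\<close> on the imbalance is zero.\<close>
      ultimately show ?case using zero_propagates[of w p x y] step.IH by simp
    qed
  qed
  then have "(\<Sum>j\<in>S k. p $ j) = 0" by simp
  then have "card (S k) = 0"
    using feas k by (simp add: feasible_def normalized_def)
  then show False using k by (auto simp: card_eq_0_iff)
qed

text \<open>Positivity allows division by the \<open>p $ i\<close>; the constraint
  \<open>0 \<le> r\<close> then follows from nonnegativity of the objective.\<close>

lemma feasible_iff:
  assumes "componentwise_strongly_connected w m S"
  shows "(p, r) \<in> feasible w m S \<longleftrightarrow>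
    p \<in> pos_vecs \<and> objective w p \<le> r \<and> r \<le> r_zero w \<and> normalized m S p"
proof
  assume "(p, r) \<in> feasible w m S"
  with feasible_pos[OF assms this] show
    "p \<in> pos_vecs \<and> objective w p \<le> r \<and> r \<le> r_zero w \<and> normalized m S p"
    by (simp add: objective_le_iff feasible_def)
next
  assume *: "p \<in> pos_vecs \<and> objective w p \<le> r \<and> r \<le> r_zero w \<and> normalized m S p"
  then have "0 \<le> r" using objective_nonneg[of p w] by linarith
  with * show "(p, r) \<in> feasible w m S"
    by (auto simp: objective_le_iff feasible_def pos_vecs_def less_imp_le)
qed

section \<open>Compactness and existence of a minimum\<close>

text \<open>All constraints are non-strict and free of quotients, hence closed conditions even where
  some \<open>p $ i\<close> vanishes.\<close>

lemma closed_feasible: "closed (feasible w m S)"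
proof -
  have "feasible w m S =
    {x. \<forall>i. 0 \<le> fst x $ i} \<inter> {x. 0 \<le> snd x} \<inter> {x. snd x \<le> r_zero w} \<inter>
    {x. \<forall>i. imbalance w (fst x) i \<le> snd x * fst x $ i} \<inter>
    (\<Inter>k\<in>{1..m}. {x. (\<Sum>i\<in>S k. fst x $ i) = real (card (S k))})"
    by (auto simp: feasible_def normalized_def)
  also have "closed \<dots>"
    unfolding imbalance_def
    by (intro closed_Int closed_INT ballI closed_Collect_all closed_Collect_le
        closed_Collect_eq continuous_intros)
  finally show ?thesis .
qed

text \<open>Entries are nonnegative, so each is at most the sum over its component, which
  normalization fixes.\<close>

lemma compact_feasible:
  assumes "componentwise_strongly_connected w m S"
  shows "compact (feasible w m S)"
proof -
  have "feasible w m S \<subseteq> cbox (0, 0) (\<chi> i. real CARD('a), r_zero w)"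
  proof
    fix x assume x: "x \<in> feasible w m S"
    obtain p r where [simp]: "x = (p, r)" by (cases x)
    have "p $ i \<le> real CARD('a)" for i
    proof -
      obtain k where k: "k \<in> {1..m}" "i \<in> S k" using componentE[OF assms] by blast
      have "p $ i \<le> (\<Sum>j\<in>S k. p $ j)"
        using x k by (intro member_le_sum) (auto simp: feasible_def)
      also have "\<dots> = real (card (S k))"
        using x k by (simp add: feasible_def normalized_def)
      also have "\<dots> \<le> real CARD('a)" by (simp add: card_mono)
      finally show ?thesis .
    qed
    then show "x \<in> cbox (0, 0) (\<chi> i. real CARD('a), r_zero w)"
      using x by (auto simp: cbox_Pair_eq mem_box_cart feasible_def)
  qed
  then have "bounded (feasible w m S)" using bounded_cbox bounded_subset by blast
  then show ?thesis using closed_feasible compact_eq_bounded_closed by blast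
qed

lemma min_solution_exists:
  assumes "componentwise_strongly_connected w m S"
  shows "\<exists>p r. min_solution w m S p r"
proof -
  \<comment> \<open>The constant vector is already normalized and shows that the feasible set is
    nonempty.\<close>
  have "((\<chi> i. 1), r_zero w) \<in> feasible w m S"
    by (simp add: feasible_iff[OF assms] one_in_pos_vecs objective_one normalized_def)
  then have "\<exists>x\<in>feasible w m S. \<forall>y\<in>feasible w m S. snd x \<le> snd y"
    using compact_feasible[OF assms]
    by (intro continuous_attains_inf) (auto intro: continuous_on_snd continuous_on_id)
  then show ?thesis by (fastforce simp: min_solution_iff)
qed

section \<open>Invariance under componentwise rescaling\<close>

definition scale_factor :: "('n \<Rightarrow> real) \<Rightarrow> 'n::finite set \<Rightarrow> real" where
  "scale_factor f A = real (card A) / (\<Sum>j\<in>A. f j)"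

lemma rescale_component:
  assumes "componentwise_strongly_connected w m S" "k \<in> {1..m}" "i \<in> S k"
  shows "rescale m S p $ i = scale_factor (($) p) (S k) * p $ i"
proof -
  have "{l. l \<in> {1..m} \<and> i \<in> S l} = {k}"
    using assms component_unique[OF assms(1)] by auto
  then show ?thesis by (simp add: rescale_def scale_factor_def)
qed

lemma sum_component_pos:
  assumes "p \<in> pos_vecs" "i \<in> A"
  shows "0 < (\<Sum>j\<in>A. p $ j)"
  using assms by (intro sum_pos) (auto simp: pos_vecs_def)

lemma scale_factor_pos:
  assumes "p \<in> pos_vecs" "i \<in> A"
  shows "0 < scale_factor (($) p) A"
  using sum_component_pos[OF assms] assms(2)
  by (auto simp: scale_factor_def card_gt_0_iff intro!: divide_pos_pos)

lemma rescale_pos: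
  assumes "componentwise_strongly_connected w m S" "p \<in> pos_vecs"
  shows "rescale m S p \<in> pos_vecs"
proof -
  have "0 < rescale m S p $ i" for i
  proof -
    obtain k where k: "k \<in> {1..m}" "i \<in> S k" using componentE[OF assms(1)] by blast
    then show ?thesis
      using rescale_component[OF assms(1) k, of p] scale_factor_pos[OF assms(2) k(2)] assms(2)
      by (simp add: pos_vecs_def)
  qed
  then show ?thesis by (simp add: pos_vecs_def)
qed

lemma rescale_normalized:
  assumes "componentwise_strongly_connected w m S" "p \<in> pos_vecs"
  shows "normalized m S (rescale m S p)"
  unfolding normalized_def
proof
  fix k assume k: "k \<in> {1..m}"
  \<comment> \<open>Strong connectivity includes a nonempty vertex set, so the denominator of the
    scale factor is positive.\<close>
  have "S k \<noteq> {}"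
    using assms(1) k
    by (auto simp: componentwise_strongly_connected_def strongly_connected_def)
  then have "0 < (\<Sum>j\<in>S k. p $ j)" using sum_component_pos[OF assms(2)] by blast
  moreover have "(\<Sum>i\<in>S k. rescale m S p $ i) = scale_factor (($) p) (S k) * (\<Sum>i\<in>S k. p $ i)"
    using rescale_component[OF assms(1) k] by (simp add: sum_distrib_left)
  ultimately show "(\<Sum>i\<in>S k. rescale m S p $ i) = real (card (S k))"
    by (simp add: scale_factor_def)
qed

text \<open>Within a component both entries carry the same factor; across components both weights
  are zero, so the differing factors do not matter.\<close>

lemma imbalance_rescale:
  assumes conn: "componentwise_strongly_connected w m S"
    and "p \<in> pos_vecs" and k: "k \<in> {1..m}" "i \<in> S k"
  shows "imbalance w (rescale m S p) i = scale_factor (($) p) (S k) * imbalance w p i"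
proof -
  let ?c = "scale_factor (($) p) (S k)" and ?q = "rescale m S p"
  have c: "0 < ?c" using scale_factor_pos assms by blast
  have "\<bar>?q $ i * w i j - ?q $ j * w j i\<bar> = ?c * \<bar>p $ i * w i j - p $ j * w j i\<bar>" for j
  proof (cases "j \<in> S k")
    case True
    have "?q $ i * w i j - ?q $ j * w j i = ?c * (p $ i * w i j - p $ j * w j i)"
      using rescale_component[OF conn k(1)] True k(2) by (simp add: algebra_simps)
    then show ?thesis using c by (simp add: abs_mult)
  next
    case False
    obtain l where l: "l \<in> {1..m}" "j \<in> S l" using componentE[OF conn] by blast
    moreover have "k \<noteq> l" using False l by blast
    ultimately have "w i j = 0 \<and> w j i = 0"
      using conn k unfolding componentwise_strongly_connected_def by simp
    then show ?thesis by simp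
  qed
  then show ?thesis by (simp add: imbalance_def sum_distrib_left)
qed

lemma objective_rescale:
  assumes conn: "componentwise_strongly_connected w m S" and p: "p \<in> pos_vecs"
  shows "objective w (rescale m S p) = objective w p"
proof -
  have "1 / rescale m S p $ i * imbalance w (rescale m S p) i = 1 / p $ i * imbalance w p i" for i
  proof -
    obtain k where k: "k \<in> {1..m}" "i \<in> S k" using componentE[OF conn] by blast
    then show ?thesis
      using scale_factor_pos[OF p k(2)] rescale_component[OF conn k]
        imbalance_rescale[OF conn p k] by simp
  qed
  then show ?thesis by (simp add: objective_def)
qed

section \<open>Equivalence of the two problems\<close>

lemma min_solution_imp_inf_solution:
  assumes conn: "componentwise_strongly_connected w m S"
    and min: "min_solution w m S p r"
  shows "inf_solution w p \<and> r = objective w p"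
proof -
  have p: "p \<in> pos_vecs" "objective w p \<le> r" "r \<le> r_zero w"
    and least: "\<And>q s. (q, s) \<in> feasible w m S \<Longrightarrow> r \<le> s"
    using min by (auto simp: min_solution_iff feasible_iff[OF conn])
  have "r \<le> objective w q" if q: "q \<in> pos_vecs" for q
  \<comment> \<open>A competitor below the cap becomes feasible after rescaling, with the same
    value; one above the cap exceeds \<open>r\<close> anyway.\<close>
  proof (cases "objective w q \<le> r_zero w")
    case True
    then have "(rescale m S q, objective w q) \<in> feasible w m S"
      using q by (simp add: feasible_iff[OF conn] rescale_pos[OF conn] rescale_normalized[OF conn]
          objective_rescale[OF conn])
    then show ?thesis by (rule least)
  next
    case False
    then show ?thesis using p by linarith
  qed
  \<comment> \<open>The bound at \<open>q = p\<close> gives \<open>r \<le> objective w p\<close>,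
    and feasibility gives the converse.\<close>
  with p show ?thesis
    by (meson inf_solution_iff order.trans order.antisym)
qed

lemma min_solution_iff_inf_solution:
  assumes conn: "componentwise_strongly_connected w m S"
  shows "min_solution w m S p r \<longleftrightarrow> r = r_star w \<and> inf_solution w p \<and> normalized m S p"
proof
  assume "min_solution w m S p r"
  with min_solution_imp_inf_solution[OF conn this]
  show "r = r_star w \<and> inf_solution w p \<and> normalized m S p"
    using r_star_eq_objective[of w p] by (auto simp: min_solution_iff feasible_iff[OF conn])
next
  assume *: "r = r_star w \<and> inf_solution w p \<and> normalized m S p"
  then have r: "r = objective w p" and p: "p \<in> pos_vecs"
    and least: "\<And>q. q \<in> pos_vecs \<Longrightarrow> objective w p \<le> objective w q"
    using r_star_eq_objective[of w p] by (auto simp: inf_solution_iff)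
  \<comment> \<open>Comparison with the constant vector yields the cap.\<close>
  have "r \<le> r_zero w"
    using least[OF one_in_pos_vecs] by (simp add: r objective_one)
  then show "min_solution w m S p r"
    using * p least by (force simp: r min_solution_iff feasible_iff[OF conn])
qed

theorem theorem4p4:
  fixes w :: "'n::finite \<Rightarrow> 'n \<Rightarrow> real" and m :: nat and S :: "nat \<Rightarrow> 'n set"
  assumes nonneg: "\<And>i j. i \<noteq> j \<Longrightarrow> 0 \<le> w i j"
    and conn: "componentwise_strongly_connected w m S"
  shows "(\<exists>p. min_solution w m S p (r_star w))
    \<and> (\<forall>p r. min_solution w m S p r \<longleftrightarrow> r = r_star w \<and> inf_solution w p \<and> normalized m S p)
    \<and> (\<forall>p\<in>pos_vecs. inf_solution w p \<longleftrightarrow> min_solution w m S (rescale m S p) (r_star w))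
    \<and> (\<exists>p\<in>pos_vecs. objective w p = r_star w)"
proof (intro conjI)
  note iff = min_solution_iff_inf_solution[OF conn]
  obtain p r where "min_solution w m S p r" using min_solution_exists[OF conn] by blast
  then have p: "min_solution w m S p (r_star w)" "inf_solution w p" by (simp_all add: iff)
  then show "\<exists>p. min_solution w m S p (r_star w)" by blast
  show "\<exists>p\<in>pos_vecs. objective w p = r_star w"
    using p(2) r_star_eq_objective[OF p(2)] by (auto simp: inf_solution_iff)
  show "\<forall>p r. min_solution w m S p r \<longleftrightarrow> r = r_star w \<and> inf_solution w p \<and> normalized m S p"
    using iff by blast
  \<comment> \<open>Rescaling keeps positivity and the objective value and enforces normalization,
    so optimality transfers both ways.\<close>
  show "\<forall>p\<in>pos_vecs. inf_solution w p \<longleftrightarrow> min_solution w m S (rescale m S p) (r_star w)"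
    by (auto simp: iff inf_solution_iff rescale_pos[OF conn] rescale_normalized[OF conn]
        objective_rescale[OF conn])
qed

end
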